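(* Let $\mathsf{G}$ be an étale groupoid and $\wedge\mathsf{G}$ its inertia groupoid. A gerbe over $\mathsf{G}$, given by a $2$-cocycle $\theta:\mathsf{G}_1\,{}_t\!\times_s\mathsf{G}_1\to \mathrm{U}(1)$, determines a morphism of groupoids $\rho:\wedge\mathsf{G}\to\overline{\mathrm{U}(1)}$, given on arrows by $$\rho(a,v)=\frac{\theta(a,v)}{\theta(v,v^{-1}av)};$$ hence it determines a line bundle over the inertia groupoid $\wedge\mathsf{G}$.
   Context: A topological groupoid $\mathsf{G}$ has objects $\mathsf{G}_0$, arrows $\mathsf{G}_1$, and source and target maps $s,t$; it is étale if $s,t$ are local homeomorphisms. Composition is written in diagrammatic order: $ab=a\cdot b$ is defined when $t(a)=s(b)$. A morphism of groupoids is a pair of continuous maps on objects and arrows commuting with all structure maps. A gerbe over $\mathsf{G}$ is here determined by a continuous $2$-cocycle $\theta:\mathsf{G}_1\,{}_t\!\times_s\mathsf{G}_1\to\mathrm{U}(1)$, i.e. $\theta(a,b)\,\theta(ab,c)=\theta(a,bc)\,\theta(b,c)$ for all composable triples $(a,b,c)$. The inertia groupoid $\wedge\mathsf{G}$ has objects $\wedge\mathsf{G}_0=\{a\in\mathsf{G}_1: s(a)=t(a)\}$ and arrows $\wedge\mathsf{G}_1=\{(a,v)\in\mathsf{G}_1\,{}_t\!\times_s\mathsf{G}_1: a\in\wedge\mathsf{G}_0\}$, with $s(a,v)=a$, $t(a,v)=v^{-1}av$, and composition $(a,v)\cdot(v^{-1}av,w)=(a,vw)$. For a group $G$, $\overline{G}$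 denotes the groupoid with one object and arrows $G$. A morphism $\rho:\mathsf{H}\to\overline{\mathrm{U}(1)}$ determines a line bundle over the groupoid $\mathsf{H}$: the bundle $\mathsf{H}_0\times\mathbb{C}$ over $\mathsf{H}_0$ with the arrow $r$ acting from the fibre at $s(r)$ to the fibre at $t(r)$ by multiplication by $\rho(r)$. *)

theory Defs
  imports "HOL-Analysis.Analysis" "HOL-Algebra.Group"
begin

record ('o, 'a) groupoid_data =
  Obj :: "'o topology"
  Arr :: "'a topology"
  src :: "'a \<Rightarrow> 'o"
  tgt :: "'a \<Rightarrow> 'o"
  cmp :: "'a \<Rightarrow> 'a \<Rightarrow> 'a"  (infixl "\<cdot>\<index>" 70)
  unt :: "'o \<Rightarrow> 'a"
  ivt :: "'a \<Rightarrow> 'a"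

text \<open>Composition is in diagrammatic order: \<open>a \<cdot> b\<close> is meaningful when \<open>tgt a = src b\<close>. The values
  of the operations outside the relevant topological spaces are irrelevant.\<close>

definition composable :: "('o, 'a) groupoid_data \<Rightarrow> ('a \<times> 'a) topology" where
  "composable G = subtopology (prod_topology (Arr G) (Arr G)) {(a, b). tgt G a = src G b}"

locale topological_groupoid =
  fixes G :: "('o, 'a) groupoid_data" (structure)
  assumes continuous_src: "continuous_map (Arr G) (Obj G) (src G)"
    and continuous_tgt: "continuous_map (Arr G) (Obj G) (tgt G)"
    and continuous_cmp: "continuous_map (composable G) (Arr G) (\<lambda>(a, b). a \<cdot> b)"
    and continuous_unt: "continuous_map (Obj G) (Arr G) (unt G)"
    and continuous_ivt: "continuous_map (Arr G) (Arr G) (ivt G)"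
    and src_cmp: "(a, b) \<in> topspace (composable G) \<Longrightarrow> src G (a \<cdot> b) = src G a"
    and tgt_cmp: "(a, b) \<in> topspace (composable G) \<Longrightarrow> tgt G (a \<cdot> b) = tgt G b"
    and src_unt: "x \<in> topspace (Obj G) \<Longrightarrow> src G (unt G x) = x"
    and tgt_unt: "x \<in> topspace (Obj G) \<Longrightarrow> tgt G (unt G x) = x"
    and src_ivt: "a \<in> topspace (Arr G) \<Longrightarrow> src G (ivt G a) = tgt G a"
    and tgt_ivt: "a \<in> topspace (Arr G) \<Longrightarrow> tgt G (ivt G a) = src G a"
    and cmp_assoc: "\<lbrakk>(a, b) \<in> topspace (composable G); (b, c) \<in> topspace (composable G)\<rbrakk>
        \<Longrightarrow> (a \<cdot> b) \<cdot> c = a \<cdot> (b \<cdot> c)"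
    and unt_cmp: "a \<in> topspace (Arr G) \<Longrightarrow> unt G (src G a) \<cdot> a = a"
    and cmp_unt: "a \<in> topspace (Arr G) \<Longrightarrow> a \<cdot> unt G (tgt G a) = a"
    and ivt_cmp: "a \<in> topspace (Arr G) \<Longrightarrow> ivt G a \<cdot> a = unt G (tgt G a)"
    and cmp_ivt: "a \<in> topspace (Arr G) \<Longrightarrow> a \<cdot> ivt G a = unt G (src G a)"

definition local_homeomorphism_map ::
    "'x topology \<Rightarrow> 'y topology \<Rightarrow> ('x \<Rightarrow> 'y) \<Rightarrow> bool" where
  "local_homeomorphism_map X Y f \<longleftrightarrow>
    (\<forall>x \<in> topspace X. \<exists>U. openin X U \<and> x \<in> U \<and> openin Y (f ` U) \<and>
       homeomorphic_map (subtopology X U) (subtopology Y (f ` U)) f)"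

locale etale_groupoid = topological_groupoid +
  assumes local_homeomorphism_src: "local_homeomorphism_map (Arr G) (Obj G) (src G)"
    and local_homeomorphism_tgt: "local_homeomorphism_map (Arr G) (Obj G) (tgt G)"

locale groupoid_morphism =
  dom: topological_groupoid H + cod: topological_groupoid K
  for H :: "('o, 'a) groupoid_data" and K :: "('p, 'b) groupoid_data" +
  fixes f0 :: "'o \<Rightarrow> 'p" and f1 :: "'a \<Rightarrow> 'b"
  assumes continuous_obj: "continuous_map (Obj H) (Obj K) f0"
    and continuous_arr: "continuous_map (Arr H) (Arr K) f1"
    and map_src: "r \<in> topspace (Arr H) \<Longrightarrow> src K (f1 r) = f0 (src H r)"
    and map_tgt: "r \<in> topspace (Arr H) \<Longrightarrow> tgt K (f1 r) = f0 (tgt H r)"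
    and map_cmp: "(q, r) \<in> topspace (composable H) \<Longrightarrow> f1 (q \<cdot>\<^bsub>H\<^esub> r) = f1 q \<cdot>\<^bsub>K\<^esub> f1 r"
    and map_unt: "x \<in> topspace (Obj H) \<Longrightarrow> f1 (unt H x) = unt K (f0 x)"
    and map_ivt: "r \<in> topspace (Arr H) \<Longrightarrow> f1 (ivt H r) = ivt K (f1 r)"

text \<open>In \<open>inertia G\<close> the pair \<open>(a, v), (b, w)\<close> is composable exactly if \<open>b\<close> is the conjugate of \<open>a\<close>
  by \<open>v\<close>, which is why \<open>cmp\<close> need not mention \<open>b\<close>.\<close>

definition inertia :: "('o, 'a) groupoid_data \<Rightarrow> ('a, 'a \<times> 'a) groupoid_data" where
  "inertia G =
    \<lparr>Obj = subtopology (Arr G) {a. src G a = tgt G a},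
     Arr = subtopology (composable G) {(a, v). src G a = tgt G a},
     src = (\<lambda>(a, v). a),
     tgt = (\<lambda>(a, v). ivt G v \<cdot>\<^bsub>G\<^esub> a \<cdot>\<^bsub>G\<^esub> v),
     cmp = (\<lambda>(a, v) (b, w). (a, v \<cdot>\<^bsub>G\<^esub> w)),
     unt = (\<lambda>a. (a, unt G (src G a))),
     ivt = (\<lambda>(a, v). (ivt G v \<cdot>\<^bsub>G\<^esub> a \<cdot>\<^bsub>G\<^esub> v, ivt G v))\<rparr>"

definition one_object_groupoid :: "'g monoid \<Rightarrow> 'g topology \<Rightarrow> (unit, 'g) groupoid_data" where
  "one_object_groupoid A T =
    \<lparr>Obj = discrete_topology {()}, Arr = T, src = (\<lambda>g. ()), tgt = (\<lambda>g. ()),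
     cmp = (\<lambda>g h. g \<otimes>\<^bsub>A\<^esub> h), unt = (\<lambda>x. \<one>\<^bsub>A\<^esub>), ivt = (\<lambda>g. inv\<^bsub>A\<^esub> g)\<rparr>"

definition U1 :: "complex monoid" where
  "U1 = \<lparr>carrier = {z. norm z = 1}, monoid.mult = (*), one = 1\<rparr>"

definition U1_topology :: "complex topology" where
  "U1_topology = top_of_set (carrier U1)"

abbreviation U1_groupoid :: "(unit, complex) groupoid_data" where
  "U1_groupoid \<equiv> one_object_groupoid U1 U1_topology"

definition gerbe_cocycle :: "('o, 'a) groupoid_data \<Rightarrow> ('a \<times> 'a \<Rightarrow> complex) \<Rightarrow> bool" where
  "gerbe_cocycle G \<theta> \<longleftrightarrow>
    continuous_map (composable G) U1_topology \<theta> \<and>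
    (\<forall>a b c. (a, b) \<in> topspace (composable G) \<and> (b, c) \<in> topspace (composable G) \<longrightarrow>
       \<theta> (a, b) * \<theta> (a \<cdot>\<^bsub>G\<^esub> b, c) = \<theta> (a, b \<cdot>\<^bsub>G\<^esub> c) * \<theta> (b, c))"

definition inertia_character ::
    "('o, 'a) groupoid_data \<Rightarrow> ('a \<times> 'a \<Rightarrow> complex) \<Rightarrow> 'a \<times> 'a \<Rightarrow> complex" where
  "inertia_character G \<theta> = (\<lambda>(a, v). \<theta> (a, v) / \<theta> (v, ivt G v \<cdot>\<^bsub>G\<^esub> a \<cdot>\<^bsub>G\<^esub> v))"

record ('o, 'a, 'e) line_bundle_data =
  Tot :: "'e topology"
  proj :: "'e \<Rightarrow> 'o"
  fadd :: "'e \<Rightarrow> 'e \<Rightarrow> 'e"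
  fscale :: "complex \<Rightarrow> 'e \<Rightarrow> 'e"
  act :: "'a \<Rightarrow> 'e \<Rightarrow> 'e"

text \<open>The fibrewise operations \<open>fadd\<close> and \<open>fscale\<close> are only meaningful within a fibre. The local
  trivialisations are required to be compatible with them, so every fibre is isomorphic to \<open>\<complex>\<close>;
  in particular the axioms of a one-dimensional complex vector space hold in each fibre.\<close>

definition line_bundle_trivialization ::
    "'o topology \<Rightarrow> ('o, 'a, 'e) line_bundle_data \<Rightarrow> 'o set \<Rightarrow> ('o \<times> complex \<Rightarrow> 'e) \<Rightarrow> bool" where
  "line_bundle_trivialization B L U \<phi> \<longleftrightarrow>
    homeomorphic_map (prod_topology (subtopology B U) euclidean)
      (subtopology (Tot L) {e. proj L e \<in> U}) \<phi> \<and>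
    (\<forall>x\<in>U. \<forall>z. proj L (\<phi> (x, z)) = x) \<and>
    (\<forall>x\<in>U. \<forall>z w. \<phi> (x, z + w) = fadd L (\<phi> (x, z)) (\<phi> (x, w))) \<and>
    (\<forall>x\<in>U. \<forall>c z. \<phi> (x, c * z) = fscale L c (\<phi> (x, z)))"

locale groupoid_line_bundle =
  topological_groupoid H for H :: "('o, 'a) groupoid_data" +
  fixes L :: "('o, 'a, 'e) line_bundle_data"
  assumes continuous_proj: "continuous_map (Tot L) (Obj H) (proj L)"
    and locally_trivial: "x \<in> topspace (Obj H) \<Longrightarrow>
        \<exists>U \<phi>. openin (Obj H) U \<and> x \<in> U \<and> line_bundle_trivialization (Obj H) L U \<phi>"
    and continuous_act:
      "continuous_map (subtopology (prod_topology (Arr H) (Tot L)) {(r, e). src H r = proj L e})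
         (Tot L) (\<lambda>(r, e). act L r e)"
    and proj_act: "\<lbrakk>r \<in> topspace (Arr H); e \<in> topspace (Tot L); proj L e = src H r\<rbrakk>
        \<Longrightarrow> proj L (act L r e) = tgt H r"
    and act_fadd: "\<lbrakk>r \<in> topspace (Arr H); e \<in> topspace (Tot L); e' \<in> topspace (Tot L);
          proj L e = src H r; proj L e' = src H r\<rbrakk>
        \<Longrightarrow> act L r (fadd L e e') = fadd L (act L r e) (act L r e')"
    and act_fscale: "\<lbrakk>r \<in> topspace (Arr H); e \<in> topspace (Tot L); proj L e = src H r\<rbrakk>
        \<Longrightarrow> act L r (fscale L c e) = fscale L c (act L r e)"
    and act_unt: "e \<in> topspace (Tot L) \<Longrightarrow> act L (unt H (proj L e)) e = e"
    and act_cmp: "\<lbrakk>(q, r) \<in> topspace (composable H); e \<in> topspace (Tot L); proj L e = src H q\<rbrakk>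
        \<Longrightarrow> act L (q \<cdot>\<^bsub>H\<^esub> r) e = act L r (act L q e)"

definition character_line_bundle ::
    "('o, 'a) groupoid_data \<Rightarrow> ('a \<Rightarrow> complex) \<Rightarrow> ('o, 'a, 'o \<times> complex) line_bundle_data" where
  "character_line_bundle H \<rho> =
    \<lparr>Tot = prod_topology (Obj H) euclidean,
     proj = fst,
     fadd = (\<lambda>(x, z) (y, w). (x, z + w)),
     fscale = (\<lambda>c (x, z). (x, c * z)),
     act = (\<lambda>r (x, z). (tgt H r, \<rho> r * z))\<rparr>"

end

theory Submission
  imports Defs
begin

text \<open>Write \<open>b = v\<^sup>-\<^sup>1 a v\<close> and \<open>c = w\<^sup>-\<^sup>1 b w\<close>. Multiplicativity of \<open>\<rho>\<close> on \<open>(a, v) \<cdot> (b, w) = (a, v w)\<close>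
  is the combination of the cocycle identities for the triples \<open>(a, v, w)\<close>, \<open>(v, b, w)\<close> and
  \<open>(v, w, c)\<close>, using \<open>a v = v b\<close> and \<open>b w = w c\<close>.\<close>

section \<open>Composable pairs and the data of the inertia groupoid\<close>

lemma topspace_composable:
  "(a, b) \<in> topspace (composable G) \<longleftrightarrow>
    a \<in> topspace (Arr G) \<and> b \<in> topspace (Arr G) \<and> tgt G a = src G b"
  by (auto simp: composable_def)

text \<open>This is the universal property of the fibre product: \<open>composable G\<close> carries
  the subspace topology of the product.\<close>

lemma continuous_map_into_composable:
  assumes "continuous_map X (Arr G) f" "continuous_map X (Arr G) g"
    and "\<And>x. x \<in> topspace X \<Longrightarrow> tgt G (f x) = src G (g x)"
  shows "continuous_map X (composable G) (\<lambda>x. (f x, g x))"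
  unfolding composable_def
  using assms by (auto simp: continuous_map_in_subtopology continuous_map_pairwise o_def)

lemma continuous_map_fst_composable: "continuous_map (composable G) (Arr G) fst"
  and continuous_map_snd_composable: "continuous_map (composable G) (Arr G) snd"
  unfolding composable_def
  by (auto intro: continuous_map_from_subtopology continuous_map_fst continuous_map_snd)

lemma inertia_simps:
  "Obj (inertia G) = subtopology (Arr G) {a. src G a = tgt G a}"
  "Arr (inertia G) = subtopology (composable G) {(a, v). src G a = tgt G a}"
  "src (inertia G) = fst"
  "tgt (inertia G) (a, v) = ivt G v \<cdot>\<^bsub>G\<^esub> a \<cdot>\<^bsub>G\<^esub> v"
  "(a, v) \<cdot>\<^bsub>inertia G\<^esub> (b, w) = (a, v \<cdot>\<^bsub>G\<^esub> w)"
  "unt (inertia G) = (\<lambda>a. (a, unt G (src G a)))"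
  "ivt (inertia G) (a, v) = (ivt G v \<cdot>\<^bsub>G\<^esub> a \<cdot>\<^bsub>G\<^esub> v, ivt G v)"
  by (auto simp: inertia_def)

lemma tgt_inertia_eq: "tgt (inertia G) = (\<lambda>r. ivt G (snd r) \<cdot>\<^bsub>G\<^esub> fst r \<cdot>\<^bsub>G\<^esub> snd r)"
  by (auto simp: inertia_def fun_eq_iff)

lemma topspace_Obj_inertia:
  "a \<in> topspace (Obj (inertia G)) \<longleftrightarrow> a \<in> topspace (Arr G) \<and> src G a = tgt G a"
  by (auto simp: inertia_simps)

lemma topspace_Arr_inertia:
  "(a, v) \<in> topspace (Arr (inertia G)) \<longleftrightarrow>
    a \<in> topspace (Arr G) \<and> v \<in> topspace (Arr G) \<and> src G a = src G v \<and> tgt G a = src G v"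
  by (auto simp: inertia_simps topspace_composable)

section \<open>Groupoid algebra\<close>

context topological_groupoid
begin

lemma continuous_map_cmp:
  assumes "continuous_map X (Arr G) f" "continuous_map X (Arr G) g"
    and "\<And>x. x \<in> topspace X \<Longrightarrow> tgt G (f x) = src G (g x)"
  shows "continuous_map X (Arr G) (\<lambda>x. f x \<cdot> g x)"
  using continuous_map_compose[OF continuous_map_into_composable[OF assms] continuous_cmp]
  by (simp add: o_def)

text \<open>Closure is contained in continuity, since \<open>continuous_map\<close> includes mapping
  one \<open>topspace\<close> into the other.\<close>

lemma arr_cmp:
  "\<lbrakk>a \<in> topspace (Arr G); b \<in> topspace (Arr G); tgt G a = src G b\<rbrakk>
    \<Longrightarrow> a \<cdot> b \<in> topspace (Arr G)"
  using continuous_map_funspace[OF continuous_cmp] funcset_mem[of _ "topspace (composable G)" _ "(a, b)"]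
  by (fastforce simp: topspace_composable)

lemma arr_ivt: "a \<in> topspace (Arr G) \<Longrightarrow> ivt G a \<in> topspace (Arr G)"
  and arr_unt: "x \<in> topspace (Obj G) \<Longrightarrow> unt G x \<in> topspace (Arr G)"
  and obj_src: "a \<in> topspace (Arr G) \<Longrightarrow> src G a \<in> topspace (Obj G)"
  and obj_tgt: "a \<in> topspace (Arr G) \<Longrightarrow> tgt G a \<in> topspace (Obj G)"
  using continuous_ivt continuous_unt continuous_src continuous_tgt
  by (auto simp: continuous_map_def)

text \<open>Composability is split into conditions that the simplifier can discharge one by
  one.\<close>

lemma src_cmp':
  "\<lbrakk>a \<in> topspace (Arr G); b \<in> topspace (Arr G); tgt G a = src G b\<rbrakk> \<Longrightarrow> src G (a \<cdot> b) = src G a"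
  and tgt_cmp':
  "\<lbrakk>a \<in> topspace (Arr G); b \<in> topspace (Arr G); tgt G a = src G b\<rbrakk> \<Longrightarrow> tgt G (a \<cdot> b) = tgt G b"
  by (simp_all add: src_cmp tgt_cmp topspace_composable)

lemma cmp_assoc':
  "\<lbrakk>a \<in> topspace (Arr G); b \<in> topspace (Arr G); c \<in> topspace (Arr G);
    tgt G a = src G b; tgt G b = src G c\<rbrakk> \<Longrightarrow> (a \<cdot> b) \<cdot> c = a \<cdot> (b \<cdot> c)"
  by (simp add: cmp_assoc topspace_composable)

text \<open>Associativity is kept out: \<open>ivt_cmp_cancel\<close> applies it from right to left,
  later proofs from left to right.\<close>

lemmas groupoid_simps = arr_cmp arr_ivt arr_unt obj_src obj_tgt src_cmp' tgt_cmp'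
  src_unt tgt_unt src_ivt tgt_ivt unt_cmp cmp_unt ivt_cmp cmp_ivt

text \<open>The product of \<open>ivt G (unt G x)\<close> with \<open>unt G x\<close> is its first
  factor by the right unit law and \<open>unt G x\<close> by the inverse law.\<close>

lemma ivt_unt:
  assumes "x \<in> topspace (Obj G)"
  shows "ivt G (unt G x) = unt G x"
  using cmp_unt[of "ivt G (unt G x)"] ivt_cmp[of "unt G x"] assms by (simp add: groupoid_simps)

text \<open>In products bracketed to the right, \<open>a\<close> and its inverse do not form a
  subterm of their own; this rule cancels them there.\<close>

lemma ivt_cmp_cancel:
  "\<lbrakk>a \<in> topspace (Arr G); b \<in> topspace (Arr G); src G a = src G b\<rbrakk> \<Longrightarrow> a \<cdot> (ivt G a \<cdot> b) = b"
  by (simp add: cmp_assoc'[symmetric] groupoid_simps)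

text \<open>Multiplication by \<open>ivt G a\<close> on the left turns a right inverse into the
  inverse.\<close>

lemma ivt_unique:
  assumes "a \<in> topspace (Arr G)" "b \<in> topspace (Arr G)" "tgt G a = src G b"
    and "a \<cdot> b = unt G (src G a)"
  shows "b = ivt G a"
proof -
  have "b = (ivt G a \<cdot> a) \<cdot> b"
    using assms by (simp add: groupoid_simps)
  also have "\<dots> = ivt G a \<cdot> (a \<cdot> b)"
    using assms by (intro cmp_assoc') (simp_all add: groupoid_simps)
  also have "\<dots> = ivt G a"
    using assms cmp_unt[of "ivt G a"] by (simp add: groupoid_simps)
  finally show ?thesis .
qed

text \<open>The inner factors cancel, so the right-hand side is a right inverse of
  \<open>a \<cdot> b\<close>.\<close>

lemma ivt_of_cmp:
  assumes "a \<in> topspace (Arr G)" "b \<in> topspace (Arr G)" "tgt G a = src G b"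
  shows "ivt G (a \<cdot> b) = ivt G b \<cdot> ivt G a"
  using assms
  by (intro ivt_unique[symmetric]) (simp_all add: groupoid_simps cmp_assoc' ivt_cmp_cancel)

section \<open>Conjugation of loops\<close>

abbreviation conjugate where
  "conjugate a v \<equiv> ivt G v \<cdot> a \<cdot> v"

lemma conjugate_closed:
  assumes "(a, v) \<in> topspace (Arr (inertia G))"
  shows "conjugate a v \<in> topspace (Arr G)"
    and "src G (conjugate a v) = tgt G v" "tgt G (conjugate a v) = tgt G v"
  using assms by (simp_all add: topspace_Arr_inertia groupoid_simps)

text \<open>Cancelling \<open>v\<close> against its inverse gives this commutation rule, through
  which cocycle identities for different triples come to share terms.\<close>

lemma cmp_conjugate:
  assumes "(a, v) \<in> topspace (Arr (inertia G))"
  shows "v \<cdot> conjugate a v = a \<cdot> v"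
  using assms
  by (simp add: topspace_Arr_inertia groupoid_simps cmp_assoc' ivt_cmp_cancel)

lemma conjugate_unt:
  assumes "a \<in> topspace (Arr G)" "src G a = tgt G a"
  shows "conjugate a (unt G (tgt G a)) = a"
  using assms unt_cmp[of a] by (simp add: groupoid_simps ivt_unt)

text \<open>Since inversion reverses products, conjugation is a right action; this makes the target
  map of the inertia groupoid respect composition.\<close>

lemma conjugate_cmp:
  assumes "(a, v) \<in> topspace (Arr (inertia G))" "w \<in> topspace (Arr G)" "tgt G v = src G w"
  shows "conjugate a (v \<cdot> w) = conjugate (conjugate a v) w"
  using assms
  by (simp add: topspace_Arr_inertia groupoid_simps cmp_assoc' ivt_of_cmp)

text \<open>By the action law this is conjugation by \<open>v \<cdot> ivt G v\<close>, which is a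
  unit.\<close>

lemma conjugate_ivt:
  assumes "(a, v) \<in> topspace (Arr (inertia G))"
  shows "conjugate (conjugate a v) (ivt G v) = a"
proof -
  have "conjugate (conjugate a v) (ivt G v) = conjugate a (v \<cdot> ivt G v)"
    using assms by (intro conjugate_cmp[symmetric]) (auto simp: topspace_Arr_inertia groupoid_simps)
  then show ?thesis
    using assms conjugate_unt[of a] by (simp add: topspace_Arr_inertia groupoid_simps)
qed

text \<open>The first arrow determines the loop of the second, so a composable pair amounts to
  \<open>a\<close>, \<open>v\<close> and \<open>w\<close>. That \<open>(b, w)\<close> is itself an
  arrow follows from \<open>conjugate_closed\<close>.\<close>

lemma topspace_composable_inertia:
  "((a, v), (b, w)) \<in> topspace (composable (inertia G)) \<longleftrightarrow>
    (a, v) \<in> topspace (Arr (inertia G)) \<and> b = conjugate a v \<and>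
    w \<in> topspace (Arr G) \<and> tgt G v = src G w"
proof (cases "(a, v) \<in> topspace (Arr (inertia G))")
  case True
  then show ?thesis
    using conjugate_closed[OF True]
    by (auto simp: topspace_composable topspace_Arr_inertia inertia_simps(3,4))
next
  case False
  then show ?thesis by (auto simp: topspace_composable)
qed

section \<open>The inertia groupoid as a topological groupoid\<close>

lemma continuous_map_into_inertia:
  assumes "continuous_map X (Arr G) f" "continuous_map X (Arr G) g"
    and "\<And>x. x \<in> topspace X \<Longrightarrow> (f x, g x) \<in> topspace (Arr (inertia G))"
  shows "continuous_map X (Arr (inertia G)) (\<lambda>x. (f x, g x))"
  unfolding inertia_simps continuous_map_in_subtopology
  using assms by (auto intro!: continuous_map_into_composable simp: topspace_Arr_inertia)

lemma continuous_map_fst_inertia: "continuous_map (Arr (inertia G)) (Arr G) fst"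
  and continuous_map_snd_inertia: "continuous_map (Arr (inertia G)) (Arr G) snd"
  unfolding inertia_simps
  by (auto intro: continuous_map_from_subtopology
      continuous_map_fst_composable continuous_map_snd_composable)

lemma continuous_map_conjugate:
  "continuous_map (Arr (inertia G)) (Arr G) (\<lambda>r. conjugate (fst r) (snd r))"
  using continuous_map_compose[OF continuous_map_snd_inertia continuous_ivt]
  by (intro continuous_map_cmp continuous_map_fst_inertia continuous_map_snd_inertia)
     (auto simp: o_def topspace_Arr_inertia groupoid_simps)

text \<open>The structure maps are built from projections and the operations of \<open>G\<close>,
  hence continuous. The algebraic laws are those of \<open>G\<close> in the second component; the
  end points match because conjugation is an action.\<close>

lemma topological_groupoid_inertia: "topological_groupoid (inertia G)"
proof
  show "continuous_map (Arr (inertia G)) (Obj (inertia G)) (src (inertia G))"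
    using continuous_map_fst_inertia
    by (auto simp: inertia_simps continuous_map_in_subtopology)
  \<comment> \<open>Objects form a subspace of \<open>Arr G\<close>, so continuity of the target map
    also requires its values to be loops.\<close>
  have "src G (tgt (inertia G) r) = tgt G (tgt (inertia G) r)"
    if "r \<in> topspace (Arr (inertia G))" for r
    using that conjugate_closed[of "fst r" "snd r"] by (simp add: tgt_inertia_eq)
  then show "continuous_map (Arr (inertia G)) (Obj (inertia G)) (tgt (inertia G))"
    using continuous_map_conjugate
    by (simp add: inertia_simps(1) continuous_map_in_subtopology tgt_inertia_eq image_subset_iff Pi_iff)
  let ?C = "composable (inertia G)"
  have C1: "continuous_map ?C (Arr G) (\<lambda>p. fst (fst p))"
    "continuous_map ?C (Arr G) (\<lambda>p. snd (fst p))"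
    "continuous_map ?C (Arr G) (\<lambda>p. snd (snd p))"
    using continuous_map_compose[OF continuous_map_fst_composable continuous_map_fst_inertia]
      continuous_map_compose[OF continuous_map_fst_composable continuous_map_snd_inertia]
      continuous_map_compose[OF continuous_map_snd_composable continuous_map_snd_inertia]
    by (simp_all add: o_def)
  have "continuous_map ?C (Arr (inertia G)) (\<lambda>p. (fst (fst p), snd (fst p) \<cdot> snd (snd p)))"
    by (intro continuous_map_into_inertia continuous_map_cmp C1)
       (auto simp: topspace_composable_inertia topspace_Arr_inertia groupoid_simps)
  moreover have "(\<lambda>p. (fst (fst p), snd (fst p) \<cdot> snd (snd p))) = (\<lambda>(q, r). q \<cdot>\<^bsub>inertia G\<^esub> r)"
    by (auto simp: inertia_simps fun_eq_iff)
  ultimately show "continuous_map ?C (Arr (inertia G)) (\<lambda>(q, r). q \<cdot>\<^bsub>inertia G\<^esub> r)"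
    by simp
  have O1: "continuous_map (Obj (inertia G)) (Arr G) (\<lambda>a. a)"
    unfolding inertia_simps by (simp add: continuous_map_from_subtopology)
  have "continuous_map (Obj (inertia G)) (Arr G) (\<lambda>a. unt G (src G a))"
    using continuous_map_compose[OF continuous_map_compose[OF O1 continuous_src] continuous_unt]
    by (simp add: o_def)
  then show "continuous_map (Obj (inertia G)) (Arr (inertia G)) (unt (inertia G))"
    unfolding inertia_simps(6)
    by (intro continuous_map_into_inertia O1)
       (auto simp: topspace_Obj_inertia topspace_Arr_inertia groupoid_simps)
  have "continuous_map (Arr (inertia G)) (Arr (inertia G))
      (\<lambda>r. (conjugate (fst r) (snd r), ivt G (snd r)))"
    using continuous_map_compose[OF continuous_map_snd_inertia continuous_ivt]
    by (intro continuous_map_into_inertia continuous_map_conjugate)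
       (auto simp: o_def topspace_Arr_inertia groupoid_simps)
  moreover have "(\<lambda>r. (conjugate (fst r) (snd r), ivt G (snd r))) = ivt (inertia G)"
    by (auto simp: inertia_simps fun_eq_iff)
  ultimately show "continuous_map (Arr (inertia G)) (Arr (inertia G)) (ivt (inertia G))"
    by simp
next
  fix q r assume "(q, r) \<in> topspace (composable (inertia G))"
  then show "src (inertia G) (q \<cdot>\<^bsub>inertia G\<^esub> r) = src (inertia G) q"
    and "tgt (inertia G) (q \<cdot>\<^bsub>inertia G\<^esub> r) = tgt (inertia G) r"
    by (cases q; cases r; simp add: inertia_simps topspace_composable_inertia conjugate_cmp)+
next
  fix a assume "a \<in> topspace (Obj (inertia G))"
  then show "src (inertia G) (unt (inertia G) a) = a" "tgt (inertia G) (unt (inertia G) a) = a"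
    by (simp_all add: inertia_simps conjugate_unt)
next
  fix p q r
  assume "(p, q) \<in> topspace (composable (inertia G))" "(q, r) \<in> topspace (composable (inertia G))"
  then show "p \<cdot>\<^bsub>inertia G\<^esub> q \<cdot>\<^bsub>inertia G\<^esub> r = p \<cdot>\<^bsub>inertia G\<^esub> (q \<cdot>\<^bsub>inertia G\<^esub> r)"
    by (cases p; cases q; cases r;
        simp add: inertia_simps(5) topspace_composable_inertia topspace_Arr_inertia cmp_assoc')
next
  fix r assume r: "r \<in> topspace (Arr (inertia G))"
  obtain a v where av: "r = (a, v)" by fastforce
  have *: "(a, v) \<in> topspace (Arr (inertia G))" using r av by simp
  \<comment> \<open>\<open>conjugate_closed\<close> places the units at the end point of
    \<open>v\<close>, and \<open>conjugate_ivt\<close> shows that the inverse arrow leads back to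
    \<open>a\<close>.\<close>
  note s = av inertia_simps(3-7) conjugate_closed[OF *] conjugate_ivt[OF *]
  show "src (inertia G) (ivt (inertia G) r) = tgt (inertia G) r"
    "tgt (inertia G) (ivt (inertia G) r) = src (inertia G) r"
    "unt (inertia G) (src (inertia G) r) \<cdot>\<^bsub>inertia G\<^esub> r = r"
    "r \<cdot>\<^bsub>inertia G\<^esub> unt (inertia G) (tgt (inertia G) r) = r"
    "ivt (inertia G) r \<cdot>\<^bsub>inertia G\<^esub> r = unt (inertia G) (tgt (inertia G) r)"
    "r \<cdot>\<^bsub>inertia G\<^esub> ivt (inertia G) r = unt (inertia G) (src (inertia G) r)"
    using * by (simp_all add: s topspace_Arr_inertia groupoid_simps)
qed

end

section \<open>The circle groupoid, and line bundles from morphisms into it\<close>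

lemma continuous_map_field_mult:
  fixes f g :: "'x \<Rightarrow> 'y::real_normed_field"
  assumes "continuous_map X euclidean f" "continuous_map X euclidean g"
  shows "continuous_map X euclidean (\<lambda>x. f x * g x)"
  using assms by (simp add: continuous_map_atin limitin_canonical_iff tendsto_mult)

text \<open>Continuity is read as a limit at each point of \<open>X\<close>; there \<open>g\<close>
  tends to a nonzero value, so the quotient rule for limits applies.\<close>

lemma continuous_map_field_divide:
  fixes f g :: "'x \<Rightarrow> 'y::real_normed_field"
  assumes "continuous_map X euclidean f" "continuous_map X euclidean g"
    and "\<And>x. x \<in> topspace X \<Longrightarrow> g x \<noteq> 0"
  shows "continuous_map X euclidean (\<lambda>x. f x / g x)"
  using assms by (simp add: continuous_map_atin limitin_canonical_iff tendsto_divide)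

lemma topspace_U1: "topspace U1_topology = {z. norm z = 1}"
  by (simp add: U1_topology_def U1_def)

lemma nonzero_of_norm_1: "norm (z::complex) = 1 \<Longrightarrow> z \<noteq> 0"
  by auto

text \<open>The definite description in \<open>m_inv\<close> is evaluated directly: the field
  inverse stays on the circle, and \<open>inverse_unique\<close> excludes any other
  candidate.\<close>

lemma inv_U1:
  assumes "norm z = 1"
  shows "inv\<^bsub>U1\<^esub> z = inverse z"
  unfolding m_inv_def using assms nonzero_of_norm_1[OF assms]
  by (intro the_equality) (auto simp: U1_def norm_inverse inverse_unique)

lemma U1_groupoid_simps:
  "Obj U1_groupoid = discrete_topology {()}" "Arr U1_groupoid = U1_topology"
  "src U1_groupoid = (\<lambda>r. ())" "tgt U1_groupoid = (\<lambda>r. ())"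
  "z \<cdot>\<^bsub>U1_groupoid\<^esub> w = z * w" "unt U1_groupoid x = 1"
  "norm z = 1 \<Longrightarrow> ivt U1_groupoid z = inverse z"
  by (simp_all add: one_object_groupoid_def inv_U1) (simp_all add: U1_def)

lemma continuous_map_U1:
  "continuous_map X U1_topology f \<longleftrightarrow>
    continuous_map X euclidean f \<and> (\<forall>x\<in>topspace X. norm (f x) = 1)"
  by (auto simp: U1_topology_def U1_def continuous_map_in_subtopology)

lemma topological_groupoid_U1: "topological_groupoid U1_groupoid"
proof
  have C: "continuous_map (composable U1_groupoid) euclidean fst"
    "continuous_map (composable U1_groupoid) euclidean snd"
    using continuous_map_fst_composable[of U1_groupoid] continuous_map_snd_composable[of U1_groupoid]
    by (auto simp: U1_groupoid_simps continuous_map_U1)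
  have "continuous_map (composable U1_groupoid) euclidean (\<lambda>p. fst p * snd p)"
    by (intro continuous_map_field_mult C)
  then show "continuous_map (composable U1_groupoid) (Arr U1_groupoid)
      (\<lambda>(a, b). a \<cdot>\<^bsub>U1_groupoid\<^esub> b)"
    by (auto simp: U1_groupoid_simps continuous_map_U1 case_prod_beta' topspace_composable
        topspace_U1 norm_mult)
  \<comment> \<open>Inversion is continuous here because the circle avoids zero.\<close>
  have "continuous_map U1_topology euclidean (inverse :: complex \<Rightarrow> complex)"
    by (auto simp: U1_topology_def U1_def intro!: continuous_intros)
  then have "continuous_map U1_topology U1_topology (inverse :: complex \<Rightarrow> complex)"
    by (simp add: continuous_map_U1 topspace_U1 norm_inverse)
  \<comment> \<open>The group inverse of \<open>U1\<close> is identified with \<open>inverse\<close>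
    only on the circle, so the two functions are compared on the \<open>topspace\<close>
    alone.\<close>
  then show "continuous_map (Arr U1_groupoid) (Arr U1_groupoid) (ivt U1_groupoid)"
    unfolding U1_groupoid_simps(2)
    by (rule continuous_map_eq) (simp add: U1_groupoid_simps topspace_U1)
qed (auto simp: U1_groupoid_simps topspace_U1 nonzero_of_norm_1)

text \<open>Units and inverses are automatically preserved, since an idempotent of \<open>U(1)\<close> is \<open>1\<close>.\<close>

lemma groupoid_morphism_U1I:
  assumes "topological_groupoid H"
    and cont: "continuous_map (Arr H) U1_topology \<rho>"
    and mult: "\<And>q r. (q, r) \<in> topspace (composable H) \<Longrightarrow> \<rho> (q \<cdot>\<^bsub>H\<^esub> r) = \<rho> q * \<rho> r"
  shows "groupoid_morphism H U1_groupoid (\<lambda>x. ()) \<rho>"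
proof -
  interpret H: topological_groupoid H by fact
  interpret U: topological_groupoid U1_groupoid by (rule topological_groupoid_U1)
  have norm: "norm (\<rho> r) = 1" if "r \<in> topspace (Arr H)" for r
    using cont that by (simp add: continuous_map_U1)
  have unt: "\<rho> (unt H x) = 1" if x: "x \<in> topspace (Obj H)" for x
  proof -
    have "\<rho> (unt H x) = \<rho> (unt H x \<cdot>\<^bsub>H\<^esub> unt H x)"
      using x H.unt_cmp[of "unt H x"] by (simp add: H.groupoid_simps)
    also have "\<dots> = \<rho> (unt H x) * \<rho> (unt H x)"
      using x by (simp add: mult topspace_composable H.groupoid_simps)
    finally show ?thesis
      using norm[OF H.arr_unt[OF x]] by auto
  qed
  have ivt: "\<rho> (ivt H r) = inverse (\<rho> r)" if r: "r \<in> topspace (Arr H)" for r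
  proof -
    have "(r, ivt H r) \<in> topspace (composable H)"
      using r by (simp add: topspace_composable H.groupoid_simps)
    then have "\<rho> r * \<rho> (ivt H r) = \<rho> (r \<cdot>\<^bsub>H\<^esub> ivt H r)"
      by (rule mult[symmetric])
    also have "\<dots> = 1"
      using r by (simp add: H.groupoid_simps unt)
    finally show ?thesis
      by (rule inverse_unique[symmetric])
  qed
  show ?thesis
    by unfold_locales (auto simp: U1_groupoid_simps cont mult unt ivt norm)
qed

text \<open>The bundle is a product, hence globally trivial. The action laws come from
  \<open>map_unt\<close> and \<open>map_cmp\<close>; as complex multiplication commutes, acting by
  \<open>q\<close> and then by \<open>r\<close> is multiplication by
  \<open>\<rho> q * \<rho> r\<close>.\<close>

lemma groupoid_line_bundle_character:
  fixes H :: "('o, 'a) groupoid_data"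
  assumes "groupoid_morphism H U1_groupoid f \<rho>"
  shows "groupoid_line_bundle H (character_line_bundle H \<rho>)"
proof -
  interpret groupoid_morphism H U1_groupoid f \<rho> by fact
  let ?L = "character_line_bundle H \<rho>"
  let ?E = "prod_topology (Obj H) euclidean :: ('o \<times> complex) topology"
  have L: "Tot ?L = ?E" "proj ?L = fst" "fadd ?L (x, z) (y, w) = (x, z + w)"
    "fscale ?L c (x, z) = (x, c * z)" "act ?L r (x, z) = (tgt H r, \<rho> r * z)" for x y z w c r
    by (simp_all add: character_line_bundle_def)
  have \<rho>: "continuous_map (Arr H) euclidean \<rho>"
    using continuous_arr by (simp add: U1_groupoid_simps continuous_map_U1)
  show ?thesis
  proof
    show "continuous_map (Tot ?L) (Obj H) (proj ?L)"
      by (simp add: L continuous_map_fst)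
    \<comment> \<open>With the whole object space as \<open>U\<close>, both restrictions in
      \<open>line_bundle_trivialization\<close> change nothing, and the identity serves as
      trivialisation.\<close>
    have sub: "subtopology ?E {e. fst e \<in> topspace (Obj H)} = ?E"
      by (rule subtopology_superset) auto
    have triv: "line_bundle_trivialization (Obj H) ?L (topspace (Obj H)) (\<lambda>e. e)"
      unfolding line_bundle_trivialization_def
      by (simp add: L sub flip: id_def)
    show "\<exists>U \<phi>. openin (Obj H) U \<and> x \<in> U \<and> line_bundle_trivialization (Obj H) ?L U \<phi>"
      if "x \<in> topspace (Obj H)" for x
      using that triv by blast
    let ?D = "subtopology (prod_topology (Arr H) (Tot ?L)) {(r, e). src H r = proj ?L e}"
    have fst: "continuous_map ?D (Arr H) fst"
      by (simp add: continuous_map_from_subtopology continuous_map_fst)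
    have snd: "continuous_map ?D ?E snd"
      by (simp add: L continuous_map_from_subtopology continuous_map_snd)
    have "continuous_map ?D ?E (\<lambda>p. (tgt H (fst p), \<rho> (fst p) * snd (snd p)))"
      using continuous_map_compose[OF fst dom.continuous_tgt] continuous_map_compose[OF fst \<rho>]
        continuous_map_compose[OF snd continuous_map_snd]
      by (intro continuous_map_pairedI continuous_map_field_mult) (simp_all add: o_def)
    moreover have "(\<lambda>p. (tgt H (fst p), \<rho> (fst p) * snd (snd p))) = (\<lambda>(r, e). act ?L r e)"
      by (auto simp: L fun_eq_iff)
    ultimately show "continuous_map ?D (Tot ?L) (\<lambda>(r, e). act ?L r e)"
      by (simp add: L)
  qed (auto simp: L U1_groupoid_simps map_cmp map_unt dom.groupoid_simps topspace_composable
      dom.tgt_cmp ring_distribs)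
qed

section \<open>The character of a gerbe on the inertia groupoid\<close>

lemma norm_gerbe_cocycle:
  assumes "gerbe_cocycle G \<theta>" "(a, b) \<in> topspace (composable G)"
  shows "norm (\<theta> (a, b)) = 1"
  using assms by (auto simp: gerbe_cocycle_def continuous_map_U1)

lemma (in topological_groupoid) inertia_character_cmp:
  assumes \<theta>: "gerbe_cocycle G \<theta>"
    and qr: "(q, r) \<in> topspace (composable (inertia G))"
  shows "inertia_character G \<theta> (q \<cdot>\<^bsub>inertia G\<^esub> r) =
    inertia_character G \<theta> q * inertia_character G \<theta> r"
proof -
  obtain a v b w where q: "q = (a, v)" and r: "r = (b, w)" by fastforce
  define c where "c = conjugate b w"
  have av: "(a, v) \<in> topspace (Arr (inertia G))" and b: "b = conjugate a v"
    and w: "w \<in> topspace (Arr G)" "tgt G v = src G w"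
    using qr by (simp_all add: q r topspace_composable_inertia)
  have bw: "(b, w) \<in> topspace (Arr (inertia G))"
    using qr by (simp add: q r topspace_composable)
  note arr = av[unfolded topspace_Arr_inertia] w bw[unfolded topspace_Arr_inertia]
    conjugate_closed[OF bw, folded c_def]
  have cocycle: "\<theta> (x, y) * \<theta> (x \<cdot> y, z) = \<theta> (x, y \<cdot> z) * \<theta> (y, z)"
    if "(x, y) \<in> topspace (composable G)" "(y, z) \<in> topspace (composable G)" for x y z
    using \<theta> that by (simp add: gerbe_cocycle_def)
  have nz: "\<theta> (x, y) \<noteq> 0" if "(x, y) \<in> topspace (composable G)" for x y
    using norm_gerbe_cocycle[OF \<theta> that] by (rule nonzero_of_norm_1)
  have 1: "\<theta> (a, v) * \<theta> (a \<cdot> v, w) = \<theta> (a, v \<cdot> w) * \<theta> (v, w)"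
    using arr by (intro cocycle) (simp_all add: topspace_composable)
  \<comment> \<open>In the identity for \<open>(v, b, w)\<close>, \<open>v \<cdot> b\<close> is
    replaced by \<open>a \<cdot> v\<close>, so that \<open>\<theta> (a \<cdot> v, w)\<close> from
    \<open>1\<close> reappears.\<close>
  have 2: "\<theta> (v, b) * \<theta> (a \<cdot> v, w) = \<theta> (v, b \<cdot> w) * \<theta> (b, w)"
    using arr cocycle[of v b w] cmp_conjugate[OF av] by (simp add: topspace_composable b)
  \<comment> \<open>In the identity for \<open>(v, w, c)\<close>, \<open>w \<cdot> c\<close> is
    replaced by \<open>b \<cdot> w\<close>, so that \<open>\<theta> (v, b \<cdot> w)\<close> from
    \<open>2\<close> reappears.\<close>
  have 3: "\<theta> (v, w) * \<theta> (v \<cdot> w, c) = \<theta> (v, b \<cdot> w) * \<theta> (w, c)"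
    using arr cocycle[of v w c] cmp_conjugate[OF bw] by (simp add: topspace_composable c_def)
  have nz': "\<theta> (a \<cdot> v, w) \<noteq> 0" "\<theta> (v, b \<cdot> w) \<noteq> 0" "\<theta> (v, w) \<noteq> 0"
    "\<theta> (v \<cdot> w, c) \<noteq> 0" "\<theta> (v, b) \<noteq> 0" "\<theta> (w, c) \<noteq> 0"
    using arr by (auto intro!: nz simp: topspace_composable groupoid_simps)
  \<comment> \<open>The second factor collects the three values that occur in the identities but not
    in the characters. It completes the product to the right side of \<open>1\<close>, the left side
    of \<open>2\<close> and the right side of \<open>3\<close>. Exchanging sides and cancelling this
    factor leaves the claim with denominators cleared.\<close>
  have "(\<theta> (a, v \<cdot> w) * \<theta> (v, b) * \<theta> (w, c)) * (\<theta> (v, w) * \<theta> (a \<cdot> v, w) * \<theta> (v, b \<cdot> w))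
      = (\<theta> (a, v \<cdot> w) * \<theta> (v, w)) * (\<theta> (v, b) * \<theta> (a \<cdot> v, w)) * (\<theta> (v, b \<cdot> w) * \<theta> (w, c))"
    by (simp add: mult_ac)
  also have "\<dots> = (\<theta> (a, v) * \<theta> (b, w) * \<theta> (v \<cdot> w, c)) *
      (\<theta> (v, w) * \<theta> (a \<cdot> v, w) * \<theta> (v, b \<cdot> w))"
    unfolding 1[symmetric] 2 3[symmetric] by (simp add: mult_ac)
  finally have "\<theta> (a, v \<cdot> w) * \<theta> (v, b) * \<theta> (w, c) = \<theta> (a, v) * \<theta> (b, w) * \<theta> (v \<cdot> w, c)"
    using nz' by simp
  then have "\<theta> (a, v \<cdot> w) / \<theta> (v \<cdot> w, c) = \<theta> (a, v) / \<theta> (v, b) * (\<theta> (b, w) / \<theta> (w, c))"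
    using nz' by (simp add: field_simps)
  \<comment> \<open>The composite ends at \<open>c\<close>, so the denominator of its character is
    \<open>\<theta> (v \<cdot> w, c)\<close>.\<close>
  moreover have "conjugate a (v \<cdot> w) = c"
    using conjugate_cmp[OF av w] by (simp add: b c_def)
  ultimately show ?thesis
    by (simp add: q r inertia_simps(5) inertia_character_def c_def flip: b)
qed

text \<open>Numerator and denominator are \<open>\<theta>\<close> pulled back along continuous maps
  into \<open>composable G\<close>. Both have norm 1, so the quotient is continuous and again lies
  on the circle.\<close>

lemma (in topological_groupoid) continuous_map_inertia_character:
  assumes \<theta>: "gerbe_cocycle G \<theta>"
  shows "continuous_map (Arr (inertia G)) U1_topology (inertia_character G \<theta>)"
proof -
  let ?A = "Arr (inertia G)"
  let ?c = "\<lambda>r. conjugate (fst r) (snd r)"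
  have cont: "continuous_map (composable G) U1_topology \<theta>"
    using \<theta> by (simp add: gerbe_cocycle_def)
  have 1: "continuous_map ?A (composable G) (\<lambda>r. (fst r, snd r))"
    by (intro continuous_map_into_composable continuous_map_fst_inertia continuous_map_snd_inertia)
       (auto simp: topspace_Arr_inertia)
  have 2: "continuous_map ?A (composable G) (\<lambda>r. (snd r, ?c r))"
    by (intro continuous_map_into_composable continuous_map_snd_inertia continuous_map_conjugate)
       (simp add: conjugate_closed)
  have num: "continuous_map ?A U1_topology (\<lambda>r. \<theta> (fst r, snd r))"
    and den: "continuous_map ?A U1_topology (\<lambda>r. \<theta> (snd r, ?c r))"
    using continuous_map_compose[OF 1 cont] continuous_map_compose[OF 2 cont]
    by (simp_all only: o_def)
  have "continuous_map ?A U1_topology (\<lambda>r. \<theta> (fst r, snd r) / \<theta> (snd r, ?c r))"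
    using num den unfolding continuous_map_U1
    by (force intro!: continuous_map_field_divide simp: norm_divide)
  then show ?thesis
    by (simp add: inertia_character_def case_prod_beta')
qed

theorem theorem6p4p2:
  fixes G :: "('o, 'a) groupoid_data"
    and \<theta> :: "'a \<times> 'a \<Rightarrow> complex"
  assumes "etale_groupoid G"
    and "gerbe_cocycle G \<theta>"
  shows "groupoid_morphism (inertia G) U1_groupoid (\<lambda>x. ()) (inertia_character G \<theta>) \<and>
         groupoid_line_bundle (inertia G)
           (character_line_bundle (inertia G) (inertia_character G \<theta>))"
proof -
  interpret etale_groupoid G by fact
  have "groupoid_morphism (inertia G) U1_groupoid (\<lambda>x. ()) (inertia_character G \<theta>)"
    using topological_groupoid_inertia continuous_map_inertia_character[OF assms(2)]
      inertia_character_cmp[OF assms(2)]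
    by (rule groupoid_morphism_U1I)
  then show ?thesis
    by (blast intro: groupoid_line_bundle_character)
qed

end
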